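(* Let $X_1,\ldots,X_n$ be nonempty finite sets with $|X_i|=q_i$, and let $X=\prod_{i=1}^n X_i$ with the RT metric $\rho$. Let $D=\{d_1,\ldots,d_k\}\subseteq\{1,\ldots,n\}$ with $1\le d_1<\cdots<d_k\le n$. Define graphs recursively by $H_1=K_{q_{d_1}}(q_1q_2\cdots q_{d_1-1})$ and $H_j=\left[(q_{d_{j-1}+1}\cdots q_{d_j-1})\,H_{j-1}\right]^{q_{d_j}}$ for $j=2,\ldots,k$. Then the distance graph satisfies $$G(X,D)\cong (q_{d_k+1}\cdots q_n)\,H_k,$$ i.e. $G(X,D)\cong q_{d_k+1}\cdots q_n\left[q_{d_{k-1}+1}\cdots q_{d_k-1}\left[\cdots\left[q_{d_1+1}\cdots q_{d_2-1}K_{q_{d_1}}(q_1\cdots q_{d_1-1})\right]^{q_{d_2}}\cdots\right]^{q_{d_{k-1}}}\right]^{q_{d_k}}$, where any empty product of the $q_i$ is taken to be $1$.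
   Context: For $x=(x_1,\ldots,x_n),y=(y_1,\ldots,y_n)\in X=\prod_{i=1}^nX_i$, the RT metric is $\rho(x,y)=\max\{i: x_i\neq y_i\}$ if $x\neq y$, and $\rho(x,x)=0$. For a metric space $(X,d)$ and a set $D$ of positive reals, the distance graph $G(X,D)$ has vertex set $X$ and an edge $xy$ for distinct $x,y\in X$ whenever $d(x,y)\in D$. For a graph $G$ and positive integer $m$, $mG$ denotes the disjoint union of $m$ copies of $G$, and $[G]^m$ denotes the join of $m$ copies of $G$ (disjoint union of the copies together with all edges between vertices of different copies). $K_r(m)$ denotes the complete $r$-partite graph with every part of size $m$. *)

theory Defs
  imports
    Complex_Main
    "HOL-Library.FuncSet"
    "Graph_Theory.Pair_Digraph"
    "Graph_Theory.Digraph_Isomorphism"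
begin

text \<open>
  A graph is a symmetric, loop-free \<^typ>\<open>'a pair_pre_digraph\<close>: an edge \<open>xy\<close> is
  represented by the two arcs \<open>(x, y)\<close> and \<open>(y, x)\<close>. Isomorphism is \<^const>\<open>digraph_iso\<close>
  of the underlying digraphs, which for such graphs is the usual notion
  (lemma \<open>digraph_iso_with_proj_iff\<close>).
\<close>

definition rt_metric :: "nat \<Rightarrow> (nat \<Rightarrow> 'a) \<Rightarrow> (nat \<Rightarrow> 'a) \<Rightarrow> real" where
  "rt_metric n x y = (if x = y then 0 else real (Max {i \<in> {1..n}. x i \<noteq> y i}))"

definition distance_graph ::
    "'a set \<Rightarrow> ('a \<Rightarrow> 'a \<Rightarrow> real) \<Rightarrow> real set \<Rightarrow> 'a pair_pre_digraph" where
  "distance_graph V \<delta> D =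
     \<lparr> pverts = V, parcs = {(x, y). x \<in> V \<and> y \<in> V \<and> x \<noteq> y \<and> \<delta> x y \<in> D} \<rparr>"

text \<open>
  The constructions below are iterated, so they must not change the vertex type. Vertices are
  therefore lists: \<open>i # v\<close> is the vertex \<open>v\<close> of the copy number \<open>i\<close>, for \<open>i < m\<close>; in
  \<open>complete_multipartite r m\<close>, \<open>[i, a]\<close> is the vertex \<open>a < m\<close> of the part \<open>i < r\<close>.
\<close>

definition graph_copies :: "nat \<Rightarrow> nat list pair_pre_digraph \<Rightarrow> nat list pair_pre_digraph" where
  "graph_copies m G =
     \<lparr> pverts = {i # v | i v. i < m \<and> v \<in> pverts G},
       parcs = {(i # u, i # v) | i u v. i < m \<and> (u, v) \<in> parcs G} \<rparr>"

definition graph_join_copies ::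
    "nat \<Rightarrow> nat list pair_pre_digraph \<Rightarrow> nat list pair_pre_digraph" where
  "graph_join_copies m G =
     \<lparr> pverts = pverts (graph_copies m G),
       parcs = parcs (graph_copies m G) \<union>
         {(i # u, j # v) | i j u v.
            i < m \<and> j < m \<and> i \<noteq> j \<and> u \<in> pverts G \<and> v \<in> pverts G} \<rparr>"

definition complete_multipartite :: "nat \<Rightarrow> nat \<Rightarrow> nat list pair_pre_digraph" where
  "complete_multipartite r m =
     \<lparr> pverts = {[i, a] | i a. i < r \<and> a < m},
       parcs = {([i, a], [j, b]) | i j a b. i < r \<and> j < r \<and> i \<noteq> j \<and> a < m \<and> b < m} \<rparr>"

text \<open>Indexed from 1; the value at 0 is left unspecified.\<close>

fun H_graph :: "(nat \<Rightarrow> nat) \<Rightarrow> (nat \<Rightarrow> nat) \<Rightarrow> nat \<Rightarrow> nat list pair_pre_digraph" where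
  "H_graph q d (Suc 0) = complete_multipartite (q (d 1)) (\<Prod>i\<in>{1..<d 1}. q i)"
| "H_graph q d (Suc (Suc j)) =
     graph_join_copies (q (d (Suc (Suc j))))
       (graph_copies (\<Prod>i\<in>{d (Suc j)<..<d (Suc (Suc j))}. q i) (H_graph q d (Suc j)))"

lemma digraph_iso_with_proj_iff:
  assumes "pair_wf_digraph G" "pair_wf_digraph H"
  shows "digraph_iso (with_proj G) (with_proj H) \<longleftrightarrow>
    (\<exists>f. bij_betw f (pverts G) (pverts H) \<and>
         (\<forall>u\<in>pverts G. \<forall>v\<in>pverts G. (u, v) \<in> parcs G \<longleftrightarrow> (f u, f v) \<in> parcs H))"
    (is "?L \<longleftrightarrow> (\<exists>f. ?R f)")
proof
  interpret G: pair_wf_digraph G by fact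
  assume ?L
  then obtain h where h: "pre_digraph.digraph_isomorphism (with_proj G) h"
    and H: "with_proj H = app_iso h (with_proj G)"
    unfolding digraph_iso_def by blast
  from H have V: "pverts H = iso_verts h ` pverts G" and A: "parcs H = iso_arcs h ` parcs G"
    and hd: "iso_head h = snd" and tl: "iso_tail h = fst"
    by (auto simp: with_proj_def app_iso_def)
  have arc: "iso_arcs h e = (iso_verts h (fst e), iso_verts h (snd e))" if "e \<in> parcs G" for e
    using h that unfolding pre_digraph.digraph_isomorphism_def
    by (auto simp: hd tl prod_eq_iff)
  have inj: "inj_on (iso_verts h) (pverts G)"
    using h unfolding pre_digraph.digraph_isomorphism_def by auto
  have "(u, v) \<in> parcs G"
    if "u \<in> pverts G" "v \<in> pverts G" "(iso_verts h u, iso_verts h v) \<in> parcs H" for u v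
  proof -
    from that(3) obtain e where e: "e \<in> parcs G" "iso_arcs h e = (iso_verts h u, iso_verts h v)"
      unfolding A by (metis imageE)
    then have "fst e = u" "snd e = v"
      using arc[OF e(1)] inj that(1,2) G.arc_fst_in_verts[OF e(1)] G.arc_snd_in_verts[OF e(1)]
      by (auto dest: inj_onD)
    with e(1) show ?thesis by auto
  qed
  moreover have "(iso_verts h u, iso_verts h v) \<in> parcs H" if "(u, v) \<in> parcs G" for u v
    using imageI[OF that, of "iso_arcs h"] arc[OF that] by (simp add: A)
  ultimately have "?R (iso_verts h)"
    using inj V unfolding bij_betw_def by blast
  then show "\<exists>f. ?R f" by blast
next
  interpret G: pair_wf_digraph G by fact
  interpret H: pair_wf_digraph H by fact
  assume "\<exists>f. ?R f"
  then obtain f where f: "bij_betw f (pverts G) (pverts H)"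
    and e: "\<And>u v. u \<in> pverts G \<Longrightarrow> v \<in> pverts G \<Longrightarrow> (u, v) \<in> parcs G \<longleftrightarrow> (f u, f v) \<in> parcs H"
    by blast
  let ?h = "\<lparr> iso_verts = f, iso_arcs = map_prod f f, iso_head = snd, iso_tail = fst \<rparr>"
  have inj: "inj_on f (pverts G)" and V: "pverts H = f ` pverts G"
    using f by (auto simp: bij_betw_def)
  have "inj_on (map_prod f f) (parcs G)"
    by (rule inj_on_subset[OF map_prod_inj_on[OF inj inj]])
      (rule subrelI, simp add: G.in_arcsD1 G.in_arcsD2)
  then have "pre_digraph.digraph_isomorphism (with_proj G) ?h"
    unfolding pre_digraph.digraph_isomorphism_def using inj G.wf_digraph by simp
  moreover have "parcs H = map_prod f f ` parcs G"
  proof (intro equalityI subrelI)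
    fix a b assume ab: "(a, b) \<in> parcs H"
    then obtain u v where "u \<in> pverts G" "v \<in> pverts G" "a = f u" "b = f v"
      using H.in_arcsD1 H.in_arcsD2 V by blast
    with ab e have "(u, v) \<in> parcs G" "(a, b) = map_prod f f (u, v)" by simp_all
    then show "(a, b) \<in> map_prod f f ` parcs G" by (rule rev_image_eqI)
  next
    fix a b assume "(a, b) \<in> map_prod f f ` parcs G"
    then obtain u v where "(u, v) \<in> parcs G" "a = f u" "b = f v" by auto
    then show "(a, b) \<in> parcs H" using e[of u v] G.in_arcsD1[of u v] G.in_arcsD2[of u v] by simp
  qed
  then have "with_proj H = app_iso ?h (with_proj G)"
    using V by (simp add: with_proj_def app_iso_def)
  ultimately show ?L unfolding digraph_iso_def by blast
qed

end

theory Submission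
  imports Defs
begin

text \<open>
  Restricting the product to the coordinates \<open>1, \<dots>, m\<close>, adjacency depends only on whether the
  topmost coordinate in which two points differ belongs to \<open>D\<close>. Adding a block of coordinates
  outside \<open>D\<close> thus turns the graph into disjoint copies of itself, indexed by the values on the
  block, while adding a single coordinate in \<open>D\<close> turns it into a join of copies. The complete
  multipartite graph is the join of copies of an edgeless graph, which is the graph on the
  coordinates below \<open>d\<^sub>1\<close>.
\<close>

text \<open>The witness \<open>i\<close> plays the part of the maximum in \<open>rt_metric\<close>.
  Avoiding \<open>Max\<close> makes the predicate simply false for points that agree on
  \<open>{1..m}\<close>, and the bound \<open>m\<close> lets it be applied to points of a longer
  product.\<close>

definition top_diff_in :: "nat set \<Rightarrow> nat \<Rightarrow> (nat \<Rightarrow> 'a) \<Rightarrow> (nat \<Rightarrow> 'a) \<Rightarrow> bool" where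
  "top_diff_in D m x y \<longleftrightarrow>
     (\<exists>i\<in>D. 1 \<le> i \<and> i \<le> m \<and> x i \<noteq> y i \<and> (\<forall>j\<in>{i<..m}. x j = y j))"

text \<open>The invariant of the induction. It asks for a bare vertex map, so each step only has to
  build a bijection; \<open>digraph_iso_with_proj_iff\<close> turns the last one into a graph
  isomorphism.\<close>

definition rt_graph_iso ::
    "(nat \<Rightarrow> 'a set) \<Rightarrow> nat set \<Rightarrow> nat \<Rightarrow> 'b pair_pre_digraph \<Rightarrow> bool" where
  "rt_graph_iso X D m G \<longleftrightarrow>
     (\<exists>f. bij_betw f (\<Pi>\<^sub>E i\<in>{1..m}. X i) (pverts G) \<and>
          (\<forall>x\<in>(\<Pi>\<^sub>E i\<in>{1..m}. X i). \<forall>y\<in>(\<Pi>\<^sub>E i\<in>{1..m}. X i).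
             top_diff_in D m x y \<longleftrightarrow> (f x, f y) \<in> parcs G))"

section \<open>The topmost differing coordinate and the RT metric\<close>

lemma top_diff_in_restrict:
  "top_diff_in D m (restrict x {1..m}) (restrict y {1..m}) \<longleftrightarrow> top_diff_in D m x y"
  by (auto simp: top_diff_in_def)

text \<open>A topmost difference in \<open>D\<close> cannot lie in a block that misses
  \<open>D\<close>. It therefore lies at or below \<open>a\<close>, and the whole block is among the
  coordinates above it, where the points agree.\<close>

lemma top_diff_in_block_disjoint:
  assumes "a \<le> b" "D \<inter> {a<..b} = {}"
  shows "top_diff_in D b x y \<longleftrightarrow> (\<forall>j\<in>{a<..b}. x j = y j) \<and> top_diff_in D a x y"
proof
  assume "top_diff_in D b x y"
  then obtain i where i: "i \<in> D" "1 \<le> i" "i \<le> b" "x i \<noteq> y i" "\<forall>j\<in>{i<..b}. x j = y j"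
    by (auto simp: top_diff_in_def)
  moreover have "i \<le> a" using i(1,3) assms(2) by (meson disjoint_iff greaterThanAtMost_iff not_le)
  ultimately show "(\<forall>j\<in>{a<..b}. x j = y j) \<and> top_diff_in D a x y"
    using assms(1) by (auto simp: top_diff_in_def intro!: bexI[of _ i])
next
  assume eq: "(\<forall>j\<in>{a<..b}. x j = y j) \<and> top_diff_in D a x y"
  then obtain i where "i \<in> D" "1 \<le> i" "i \<le> a" "x i \<noteq> y i" "\<forall>j\<in>{i<..a}. x j = y j"
    by (auto simp: top_diff_in_def)
  moreover from this eq have "\<forall>j\<in>{i<..b}. x j = y j"
    by (metis greaterThanAtMost_iff not_le_imp_less)
  ultimately show "top_diff_in D b x y"
    using assms(1) by (auto simp: top_diff_in_def intro!: bexI[of _ i])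
qed

text \<open>A difference at \<open>Suc m\<close> is automatically the topmost one and lies in
  \<open>D\<close>; without it the topmost difference is sought among the first \<open>m\<close>
  coordinates.\<close>

lemma top_diff_in_Suc:
  assumes "Suc m \<in> D"
  shows "top_diff_in D (Suc m) x y \<longleftrightarrow> x (Suc m) \<noteq> y (Suc m) \<or> top_diff_in D m x y"
proof (cases "x (Suc m) = y (Suc m)")
  case True
  then show ?thesis
    unfolding top_diff_in_def by (auto simp: le_Suc_eq) (metis greaterThanAtMost_iff le_Suc_eq)
next
  case False
  then show ?thesis
    using assms by (auto simp: top_diff_in_def intro!: bexI[of _ "Suc m"])
qed

lemma rt_metric_in_iff_top_diff_in:
  assumes "x \<in> extensional {1..n}" "y \<in> extensional {1..n}"
  shows "x \<noteq> y \<and> rt_metric n x y \<in> real ` D \<longleftrightarrow> top_diff_in D n x y"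
proof (cases "x = y")
  case True
  then show ?thesis by (simp add: top_diff_in_def)
next
  case False
  let ?S = "{i \<in> {1..n}. x i \<noteq> y i}"
  \<comment> \<open>Extensionality forces distinct points to differ inside \<open>{1..n}\<close>, so
    \<open>Max ?S\<close> is a genuine maximum.\<close>
  have ne: "?S \<noteq> {}" using False assms by (auto intro: extensionalityI)
  \<comment> \<open>Stated for every \<open>i\<close>, so that unfolding it under the quantifier
    over \<open>D\<close> yields the body of \<open>top_diff_in\<close>.\<close>
  have M: "Max ?S = i \<longleftrightarrow> 1 \<le> i \<and> i \<le> n \<and> x i \<noteq> y i \<and> (\<forall>j\<in>{i<..n}. x j = y j)" for i
  proof -
    have "Max ?S = i \<longleftrightarrow> i \<in> ?S \<and> (\<forall>j\<in>?S. j \<le> i)"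
      by (rule Max_eq_iff) (use ne in simp_all)
    also have "\<dots> \<longleftrightarrow> 1 \<le> i \<and> i \<le> n \<and> x i \<noteq> y i \<and> (\<forall>j\<in>{i<..n}. x j = y j)"
    proof -
      have "(\<forall>j\<in>?S. j \<le> i) \<longleftrightarrow> (\<forall>j\<in>{i<..n}. x j = y j)"
      proof
        assume le: "\<forall>j\<in>?S. j \<le> i"
        show "\<forall>j\<in>{i<..n}. x j = y j"
        proof (rule ballI, rule ccontr)
          fix j assume "j \<in> {i<..n}" "x j \<noteq> y j"
          then show False using bspec[OF le, of j] by simp
        qed
      next
        assume eq: "\<forall>j\<in>{i<..n}. x j = y j"
        show "\<forall>j\<in>?S. j \<le> i"
        proof (rule ballI, rule ccontr)
          fix j assume "j \<in> ?S" "\<not> j \<le> i"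
          then show False using bspec[OF eq, of j] by simp
        qed
      qed
      then show ?thesis by simp
    qed
    finally show ?thesis .
  qed
  have "x \<noteq> y \<and> rt_metric n x y \<in> real ` D \<longleftrightarrow> (\<exists>i\<in>D. Max ?S = i)"
    using False by (auto simp: rt_metric_def)
  then show ?thesis unfolding M top_diff_in_def .
qed

section \<open>Splitting the product and numbering a block\<close>

lemma bij_betw_PiE_split:
  fixes a b :: nat
  assumes "a \<le> b"
  shows "bij_betw (\<lambda>x. (restrict x {a<..b}, restrict x {1..a}))
    (\<Pi>\<^sub>E i\<in>{1..b}. X i) ((\<Pi>\<^sub>E i\<in>{a<..b}. X i) \<times> (\<Pi>\<^sub>E i\<in>{1..a}. X i))"
  using assms
  \<comment> \<open>The inverse glues the two pieces at \<open>a\<close>. Outside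
    \<open>{1..b}\<close> it is \<open>undefined\<close>, inherited from \<open>v\<close> at index 0
    and from \<open>u\<close> above \<open>b\<close>, so the glued function is extensional.\<close>
  by (intro bij_betw_byWitness[where f' = "\<lambda>(u, v). (\<lambda>i. if i \<le> a then v i else u i)"])
    (auto simp: fun_eq_iff PiE_def extensional_def restrict_def Pi_def)

lemma ex_bij_betw_PiE_prod_card:
  assumes "finite I" "\<And>i. i \<in> I \<Longrightarrow> finite (X i)" "\<And>i. i \<in> I \<Longrightarrow> card (X i) = q i"
  shows "\<exists>g. bij_betw g (\<Pi>\<^sub>E i\<in>I. X i) {..<\<Prod>i\<in>I. q i}"
proof -
  have "card (\<Pi>\<^sub>E i\<in>I. X i) = (\<Prod>i\<in>I. q i)" "finite (\<Pi>\<^sub>E i\<in>I. X i)"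
    using assms by (simp_all add: card_PiE finite_PiE)
  then show ?thesis
    using ex_bij_betw_finite_nat[of "\<Pi>\<^sub>E i\<in>I. X i"] by (simp add: atLeast0LessThan)
qed

text \<open>One vertex map serves both constructions, since copies and joins of copies have the same
  vertex set: the number of the block values is the copy index.\<close>

lemma bij_betw_PiE_copies:
  fixes a b :: nat
  assumes "a \<le> b" and g: "bij_betw g (\<Pi>\<^sub>E i\<in>{a<..b}. X i) {..<m}"
    and f: "bij_betw f (\<Pi>\<^sub>E i\<in>{1..a}. X i) V"
  shows "bij_betw (\<lambda>x. g (restrict x {a<..b}) # f (restrict x {1..a}))
    (\<Pi>\<^sub>E i\<in>{1..b}. X i) {i # v | i v. i < m \<and> v \<in> V}"
proof -
  have "bij_betw (\<lambda>(i, v). i # v) ({..<m} \<times> V) {i # v | i v. i < m \<and> v \<in> V}"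
    by (auto simp: bij_betw_def inj_on_def image_def)
  from bij_betw_trans[OF bij_betw_trans[OF bij_betw_PiE_split[OF assms(1)]
      bij_betw_map_prod[OF g f]] this]
  show ?thesis by (simp add: o_def)
qed

section \<open>Extending an isomorphism by copies, by a join, and from an edgeless graph\<close>

lemma Cons_arc_graph_copies:
  "(i # u, j # v) \<in> parcs (graph_copies m G) \<longleftrightarrow> i < m \<and> i = j \<and> (u, v) \<in> parcs G"
  by (auto simp: graph_copies_def)

lemma Cons_arc_graph_join_copies:
  "(i # u, j # v) \<in> parcs (graph_join_copies m G) \<longleftrightarrow>
     i < m \<and> j < m \<and>
     (i = j \<and> (u, v) \<in> parcs G \<or> i \<noteq> j \<and> u \<in> pverts G \<and> v \<in> pverts G)"
  by (auto simp: graph_join_copies_def graph_copies_def)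

text \<open>By \<open>top_diff_in_block_disjoint\<close>, adjacent points share their block values,
  hence their copy index because \<open>g\<close> is injective, and are adjacent below the
  block.\<close>

lemma rt_graph_iso_copies:
  assumes "a \<le> b" "D \<inter> {a<..b} = {}" "rt_graph_iso X D a G"
    and fin: "\<And>i. i \<in> {a<..b} \<Longrightarrow> finite (X i)"
    and card: "\<And>i. i \<in> {a<..b} \<Longrightarrow> card (X i) = q i"
  shows "rt_graph_iso X D b (graph_copies (\<Prod>i\<in>{a<..b}. q i) G)"
proof -
  let ?P = "\<lambda>I. \<Pi>\<^sub>E i\<in>I. X i" and ?m = "\<Prod>i\<in>{a<..b}. q i"
  obtain f where f: "bij_betw f (?P {1..a}) (pverts G)"
    and adj: "\<And>x y. x \<in> ?P {1..a} \<Longrightarrow> y \<in> ?P {1..a} \<Longrightarrow>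
      top_diff_in D a x y \<longleftrightarrow> (f x, f y) \<in> parcs G"
    using assms(3) unfolding rt_graph_iso_def by blast
  obtain g where g: "bij_betw g (?P {a<..b}) {..<?m}"
    using ex_bij_betw_PiE_prod_card[of "{a<..b}" X q] fin card by auto
  let ?F = "\<lambda>x. g (restrict x {a<..b}) # f (restrict x {1..a})"
  have "top_diff_in D b x y \<longleftrightarrow> (?F x, ?F y) \<in> parcs (graph_copies ?m G)"
    if xy: "x \<in> ?P {1..b}" "y \<in> ?P {1..b}" for x y
  proof -
    have r: "restrict x {a<..b} \<in> ?P {a<..b}" "restrict y {a<..b} \<in> ?P {a<..b}"
      "restrict x {1..a} \<in> ?P {1..a}" "restrict y {1..a} \<in> ?P {1..a}"
      using xy assms(1) by auto
    have "(\<forall>j\<in>{a<..b}. x j = y j) \<longleftrightarrow> restrict x {a<..b} = restrict y {a<..b}"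
      by (auto simp: fun_eq_iff restrict_def)
    also have "\<dots> \<longleftrightarrow> g (restrict x {a<..b}) = g (restrict y {a<..b})"
      using inj_on_eq_iff[OF bij_betw_imp_inj_on[OF g] r(1,2)] by (rule sym)
    finally have "top_diff_in D b x y \<longleftrightarrow> g (restrict x {a<..b}) = g (restrict y {a<..b}) \<and>
        (f (restrict x {1..a}), f (restrict y {1..a})) \<in> parcs G"
      \<comment> \<open>Read backwards, \<open>adj\<close> turns the arc of \<open>G\<close> into
        \<open>top_diff_in\<close> of the restrictions, which is that of \<open>x\<close> and
        \<open>y\<close>.\<close>
      unfolding top_diff_in_block_disjoint[OF assms(1,2)] adj[OF r(3,4), symmetric]
        top_diff_in_restrict by (rule conj_cong) (rule refl)
    moreover have "g (restrict x {a<..b}) < ?m"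
      using bij_betwE[OF g] r(1) by blast
    ultimately show ?thesis unfolding Cons_arc_graph_copies by blast
  qed
  then show ?thesis
    using bij_betw_PiE_copies[OF assms(1) g f]
    unfolding rt_graph_iso_def by (intro exI[of _ ?F]) (simp add: graph_copies_def)
qed

text \<open>Points with different values at \<open>Suc m\<close> are always adjacent, which gives
  all arcs between different copies; equal values leave the adjacency of \<open>G\<close>.\<close>

lemma rt_graph_iso_join:
  assumes "Suc m \<in> D" "rt_graph_iso X D m G"
    and fin: "finite (X (Suc m))" and card: "card (X (Suc m)) = r"
  shows "rt_graph_iso X D (Suc m) (graph_join_copies r G)"
proof -
  let ?P = "\<lambda>I. \<Pi>\<^sub>E i\<in>I. X i"
  obtain f where f: "bij_betw f (?P {1..m}) (pverts G)"
    and adj: "\<And>x y. x \<in> ?P {1..m} \<Longrightarrow> y \<in> ?P {1..m} \<Longrightarrow>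
      top_diff_in D m x y \<longleftrightarrow> (f x, f y) \<in> parcs G"
    using assms(2) unfolding rt_graph_iso_def by blast
  \<comment> \<open>The single coordinate is kept as an interval, the shape
    \<open>bij_betw_PiE_copies\<close> expects.\<close>
  have block: "{m<..Suc m} = {Suc m}" by auto
  obtain g where g: "bij_betw g (?P {m<..Suc m}) {..<r}"
    using ex_bij_betw_PiE_prod_card[of "{m<..Suc m}" X "\<lambda>_. r"] fin card by (auto simp: block)
  let ?F = "\<lambda>x. g (restrict x {m<..Suc m}) # f (restrict x {1..m})"
  have "top_diff_in D (Suc m) x y \<longleftrightarrow> (?F x, ?F y) \<in> parcs (graph_join_copies r G)"
    if xy: "x \<in> ?P {1..Suc m}" "y \<in> ?P {1..Suc m}" for x y
  proof -
    have res: "restrict x {m<..Suc m} \<in> ?P {m<..Suc m}" "restrict y {m<..Suc m} \<in> ?P {m<..Suc m}"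
      "restrict x {1..m} \<in> ?P {1..m}" "restrict y {1..m} \<in> ?P {1..m}"
      using xy by auto
    have "x (Suc m) = y (Suc m) \<longleftrightarrow> restrict x {m<..Suc m} = restrict y {m<..Suc m}"
      by (auto simp: block fun_eq_iff restrict_def)
    also have "\<dots> \<longleftrightarrow> g (restrict x {m<..Suc m}) = g (restrict y {m<..Suc m})"
      using inj_on_eq_iff[OF bij_betw_imp_inj_on[OF g] res(1,2)] by (rule sym)
    finally have "top_diff_in D (Suc m) x y \<longleftrightarrow>
        \<not> g (restrict x {m<..Suc m}) = g (restrict y {m<..Suc m}) \<or>
        (f (restrict x {1..m}), f (restrict y {1..m})) \<in> parcs G"
      unfolding top_diff_in_Suc[OF assms(1)] adj[OF res(3,4), symmetric] top_diff_in_restrict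
      by (rule arg_cong)
    moreover have "g (restrict x {m<..Suc m}) < r" "g (restrict y {m<..Suc m}) < r"
      using bij_betwE[OF g] res(1,2) by blast+
    moreover have "f (restrict x {1..m}) \<in> pverts G" "f (restrict y {1..m}) \<in> pverts G"
      using bij_betwE[OF f] res(3,4) by blast+
    ultimately show ?thesis unfolding Cons_arc_graph_join_copies by blast
  qed
  then show ?thesis
    using bij_betw_PiE_copies[OF _ g f]
    unfolding rt_graph_iso_def
    by (intro exI[of _ ?F]) (simp add: graph_join_copies_def graph_copies_def)
qed

text \<open>Vertices are one-element lists, so that prefixing a copy index gives exactly the
  vertices \<open>[i, a]\<close> of \<open>complete_multipartite\<close>.\<close>

definition edgeless_graph :: "nat \<Rightarrow> nat list pair_pre_digraph" where
  "edgeless_graph m = \<lparr> pverts = {[a] | a. a < m}, parcs = {} \<rparr>"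

lemma complete_multipartite_eq_join_edgeless:
  "complete_multipartite r m = graph_join_copies r (edgeless_graph m)"
  by (auto simp: complete_multipartite_def graph_join_copies_def graph_copies_def
      edgeless_graph_def)

lemma rt_graph_iso_edgeless:
  assumes "D \<inter> {1..m} = {}"
    and "\<And>i. i \<in> {1..m} \<Longrightarrow> finite (X i)" "\<And>i. i \<in> {1..m} \<Longrightarrow> card (X i) = q i"
  shows "rt_graph_iso X D m (edgeless_graph (\<Prod>i\<in>{1..m}. q i))"
proof -
  let ?p = "\<Prod>i\<in>{1..m}. q i"
  obtain g where g: "bij_betw g (\<Pi>\<^sub>E i\<in>{1..m}. X i) {..<?p}"
    using ex_bij_betw_PiE_prod_card[of "{1..m}" X q] assms(2,3) by auto
  have "bij_betw (\<lambda>a. [a]) {..<?p} (pverts (edgeless_graph ?p))"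
    by (auto simp: bij_betw_def inj_on_def edgeless_graph_def)
  from bij_betw_trans[OF g this]
  have "bij_betw (\<lambda>x. [g x]) (\<Pi>\<^sub>E i\<in>{1..m}. X i) (pverts (edgeless_graph ?p))"
    by (simp add: o_def)
  moreover have "\<not> top_diff_in D m x y" for x y :: "nat \<Rightarrow> 'a"
    using assms(1) by (auto simp: top_diff_in_def)
  ultimately show ?thesis
    unfolding rt_graph_iso_def by (intro exI[of _ "\<lambda>x. [g x]"]) (simp add: edgeless_graph_def)
qed

section \<open>Well-formedness and the induction along \<open>D\<close>\<close>

lemma pair_wf_digraph_graph_copies:
  assumes "pair_wf_digraph G"
  shows "pair_wf_digraph (graph_copies m G)"
  using assms by (auto simp: pair_wf_digraph_def graph_copies_def)

lemma pair_wf_digraph_graph_join_copies: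
  assumes "pair_wf_digraph G"
  shows "pair_wf_digraph (graph_join_copies m G)"
  using assms by (auto simp: pair_wf_digraph_def graph_join_copies_def graph_copies_def)

lemma pair_wf_digraph_H_graph: "pair_wf_digraph (H_graph q d (Suc j))"
proof (induction j)
  case 0
  then show ?case
    by (auto simp: pair_wf_digraph_def complete_multipartite_def)
next
  case (Suc j)
  then show ?case
    by (simp add: pair_wf_digraph_graph_copies pair_wf_digraph_graph_join_copies)
qed

lemma rt_graph_iso_H_graph:
  assumes fin: "\<And>i. i \<in> {1..n} \<Longrightarrow> finite (X i)"
    and card: "\<And>i. i \<in> {1..n} \<Longrightarrow> card (X i) = q i"
    and mono: "strict_mono_on {1..k} d"
    and D: "d ` {1..k} \<subseteq> {1..n}"
    and j: "Suc j \<le> k"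
  shows "rt_graph_iso X (d ` {1..k}) (d (Suc j)) (H_graph q d (Suc j))"
  using j
proof (induction j)
  case 0
  have d1: "1 \<le> d 1" "d 1 \<le> n" using D 0 by (simp_all add: image_subset_iff)
  \<comment> \<open>\<open>m\<close> may be 0; the edgeless graph then has one vertex, the empty
    product being 1.\<close>
  then obtain m where m: "d 1 = Suc m" by (cases "d 1") auto
  have "d 1 \<le> d i" if "i \<in> {1..k}" for i
    using strict_mono_on_leD[OF mono, of 1 i] that by auto
  then have "d ` {1..k} \<inter> {1..m} = {}" using m by force
  then have "rt_graph_iso X (d ` {1..k}) m (edgeless_graph (\<Prod>i\<in>{1..m}. q i))"
    using fin card d1 m by (intro rt_graph_iso_edgeless) auto
  then have "rt_graph_iso X (d ` {1..k}) (Suc m)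
      (graph_join_copies (q (Suc m)) (edgeless_graph (\<Prod>i\<in>{1..m}. q i)))"
    using fin card d1 m 0 by (intro rt_graph_iso_join) (auto intro: rev_image_eqI[of 1])
  moreover have "{1..<Suc m} = {1..m}" by auto
  ultimately show ?case
    using m by (simp add: complete_multipartite_eq_join_edgeless)
next
  case (Suc j)
  let ?a = "d (Suc j)" and ?c = "d (Suc (Suc j))"
  have lt: "?a < ?c" using strict_mono_onD[OF mono, of "Suc j" "Suc (Suc j)"] Suc.prems by auto
  have cn: "?c \<le> n" using D Suc.prems by (simp add: image_subset_iff)
  obtain m where m: "?c = Suc m" using lt by (cases ?c) auto
  \<comment> \<open>By monotonicity, indices up to \<open>Suc j\<close> give values at most
    \<open>?a\<close>, and later ones give values at least \<open>?c\<close>, which exceeds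
    \<open>m\<close>.\<close>
  have "d i \<notin> {?a<..m}" if i: "i \<in> {1..k}" for i
  proof (cases "i \<le> Suc j")
    case True
    then show ?thesis using strict_mono_on_leD[OF mono, of i "Suc j"] i Suc.prems by auto
  next
    case False
    then show ?thesis
      using strict_mono_on_leD[OF mono, of "Suc (Suc j)" i] i Suc.prems m by auto
  qed
  then have "d ` {1..k} \<inter> {?a<..m} = {}" by auto
  then have "rt_graph_iso X (d ` {1..k}) m
      (graph_copies (\<Prod>i\<in>{?a<..m}. q i) (H_graph q d (Suc j)))"
    using Suc lt m fin card cn by (intro rt_graph_iso_copies) auto
  then have "rt_graph_iso X (d ` {1..k}) (Suc m) (graph_join_copies (q (Suc m))
      (graph_copies (\<Prod>i\<in>{?a<..m}. q i) (H_graph q d (Suc j))))"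
    using fin card cn m Suc.prems
    by (intro rt_graph_iso_join) (auto intro: rev_image_eqI[of "Suc (Suc j)"])
  moreover have "{?a<..<Suc m} = {?a<..m}" by auto
  ultimately show ?case using m by simp
qed

lemma digraph_iso_distance_graph:
  assumes "rt_graph_iso X D n G" "pair_wf_digraph G"
  shows "digraph_iso
    (with_proj (distance_graph (\<Pi>\<^sub>E i\<in>{1..n}. X i) (rt_metric n) (real ` D))) (with_proj G)"
proof -
  let ?G = "distance_graph (\<Pi>\<^sub>E i\<in>{1..n}. X i) (rt_metric n) (real ` D)"
  have wf: "pair_wf_digraph ?G" by (auto simp: pair_wf_digraph_def distance_graph_def)
  have "(x, y) \<in> parcs ?G \<longleftrightarrow> top_diff_in D n x y"
    if "x \<in> (\<Pi>\<^sub>E i\<in>{1..n}. X i)" "y \<in> (\<Pi>\<^sub>E i\<in>{1..n}. X i)" for x y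
    using that rt_metric_in_iff_top_diff_in[of x n y D] by (simp add: distance_graph_def PiE_def)
  then show ?thesis
    using assms(1) unfolding digraph_iso_with_proj_iff[OF wf assms(2)] rt_graph_iso_def
    by (simp add: distance_graph_def)
qed

theorem theorem3p2:
  fixes X :: "nat \<Rightarrow> 'a set" and q d :: "nat \<Rightarrow> nat" and n k :: nat and D :: "nat set"
  assumes "\<And>i. i \<in> {1..n} \<Longrightarrow> finite (X i)"
    and "\<And>i. i \<in> {1..n} \<Longrightarrow> X i \<noteq> {}"
    and "\<And>i. i \<in> {1..n} \<Longrightarrow> card (X i) = q i"
    and "1 \<le> k"
    and "strict_mono_on {1..k} d"
    and "D = d ` {1..k}"
    and "D \<subseteq> {1..n}"
  shows "digraph_iso
    (with_proj (distance_graph (\<Pi>\<^sub>E i\<in>{1..n}. X i) (rt_metric n) (real ` D)))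
    (with_proj (graph_copies (\<Prod>i\<in>{d k<..n}. q i) (H_graph q d k)))"
proof -
  obtain j where k: "k = Suc j" using assms(4) by (cases k) auto
  have H: "rt_graph_iso X D (d k) (H_graph q d k)"
    using rt_graph_iso_H_graph[of n X q k d j] assms(1,3,5-7) k by simp
  have "d i \<le> d k" if "i \<in> {1..k}" for i
    using strict_mono_on_leD[OF assms(5), of i k] that by auto
  \<comment> \<open>As \<open>d k\<close> is the largest element of \<open>D\<close>, the remaining
    coordinates form a last block of copies.\<close>
  then have "D \<inter> {d k<..n} = {}" using assms(6) by force
  moreover have "d k \<le> n" using assms(4,6,7) by (simp add: image_subset_iff)
  ultimately have "rt_graph_iso X D n (graph_copies (\<Prod>i\<in>{d k<..n}. q i) (H_graph q d k))"
    using assms(1,3) H by (intro rt_graph_iso_copies) auto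
  then show ?thesis
    using pair_wf_digraph_H_graph[of q d j] k
    by (intro digraph_iso_distance_graph pair_wf_digraph_graph_copies) simp_all
qed

end
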